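(* Let $(X,0)\subsetneq(\mathbb{R}^n,0)$ be a closed definable germ satisfying $\mathrm{Aff}(C_0X)=\mathbb{R}^k\times\{0\}^{n-k}$ for some $1\leqslant k<n$, and let $v\in V_0^C(X)$ be a camber direction. If $\theta_v(X,0)<2$, then $0\in\overline{M_X}$. Actually, there is a constant $C>0$ such that $$0\in\overline{M_X\cap\{z\oplus tv\in(\mathbb{R}v)^\perp\oplus\mathbb{R}v\mid |t|>C\|z\|^{\theta_v(X,0)}\}}.$$ Moreover, $\dim (C_0M_X\cap\mathbb{R}v)=1$, i.e. either $v$ or $-v$ is tangent to $M_X$ at the origin (belongs to $C_0M_X$).
   Context: "Definable" means definable in a fixed polynomially bounded o-minimal structure on the field $\mathbb{R}$. The germ is represented by a closed definable set $X\subset\mathbb{R}^n$ with $0\in X$. $m(p)=\{x\in X\mid \|p-x\|=d(p,X)\}$ (Euclidean distance), and the medial axis is $M_X=\{p\in\mathbb{R}^n\mid \# m(p)>1\}$. For $E\subset\mathbb{R}^n$ and $0\in\overline{E}$, the Peano tangent cone is $C_0E=\{w\mid \exists\,E\ni x_\nu\to 0,\ \exists\,\lambda_\nu>0:\ \lambda_\nu x_\nu\to w\}$; $\mathrm{Aff}$ denotes the affine hull. The camber directions are the elements of $V_0^C(X)=(\{0\}^k\times\mathbb{R}^{n-k})\cap\mathbb{S}^{n-1}$. For $v\in V_0^C(X)$, decompose $\mathbb{R}^n=(\mathbb{R}v)^\perp\oplus\mathbb{R}v$, and for $\theta,c>0$ put $P_v(\theta,c)=\{z\oplus tv\mid |t|\leqslant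 c\|z\|^\theta\}$. The directional curvature of $(X,0)$ in the direction $v$ is $\theta_v(X,0)=\sup\{\theta>0\mid (X,0)\subset P_v(\theta,c)\text{ for some } c>0\}\in[1,+\infty]$, where inclusion of germs means that some representative (intersection of $X$ with a neighbourhood of $0$) is contained in the right-hand set. *)

theory Defs
  imports "HOL-Analysis.Analysis"
begin

section \<open>Polynomially bounded o-minimal structures on the real field\<close>

text \<open>
  A structure has to speak about all finite dimensions at once, so here a point of the
  \<open>m\<close>-dimensional space is a real list of length \<open>m\<close>, and \<open>S m\<close> is the family
  of definable subsets of that space. The axioms are those of van den Dries.
\<close>

text \<open>Open intervals with possibly infinite end points, and singletons.\<close>

definition intervals_and_points :: "real set set" where
  "intervals_and_points =
     {{x. a < ereal x \<and> ereal x < b} | a b. True} \<union> {{a} | a. True}"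

locale o_minimal_structure =
  fixes S :: "nat \<Rightarrow> real list set set"
  assumes length_definable: "A \<in> S m \<Longrightarrow> x \<in> A \<Longrightarrow> length x = m"
    and empty_definable: "{} \<in> S m"
    and union_definable: "A \<in> S m \<Longrightarrow> B \<in> S m \<Longrightarrow> A \<union> B \<in> S m"
    and complement_definable: "A \<in> S m \<Longrightarrow> {x. length x = m} - A \<in> S m"
    and times_line_definable: "A \<in> S m \<Longrightarrow> {x @ [t] | x t. x \<in> A} \<in> S (Suc m)"
    and line_times_definable: "A \<in> S m \<Longrightarrow> {t # x | x t. x \<in> A} \<in> S (Suc m)"
    and diagonal_definable: "m \<ge> 1 \<Longrightarrow> {x. length x = m \<and> x ! 0 = x ! (m - 1)} \<in> S m"
    and projection_definable: "A \<in> S (Suc m) \<Longrightarrow> butlast ` A \<in> S m"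
    and less_definable: "{[x, y] | x y. x < y} \<in> S 2"
    and add_definable: "{[x, y, x + y] | x y. True} \<in> S 3"
    and mult_definable: "{[x, y, x * y] | x y. True} \<in> S 3"
    and o_minimality:
      "S 1 = {(\<lambda>x. [x]) ` (\<Union>F) | F. finite F \<and> F \<subseteq> intervals_and_points}"

locale polynomially_bounded_o_minimal_structure = o_minimal_structure +
  assumes polynomially_bounded:
    "{[t, f t] | t. True} \<in> S 2 \<Longrightarrow> \<exists>N::nat. \<forall>\<^sub>F t in at_top. \<bar>f t\<bar> \<le> t ^ N"

text \<open>
  The index type of \<open>real ^ 'n\<close> is linearly ordered, so that a vector has a well-defined
  list of coordinates, and "the first \<open>k\<close> coordinates" makes sense.
\<close>

definition coordinates :: "real ^ 'n::{finite,linorder} \<Rightarrow> real list" where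
  "coordinates x = map (\<lambda>i. x $ i) (sorted_list_of_set UNIV)"

definition definable ::
    "(nat \<Rightarrow> real list set set) \<Rightarrow> (real ^ 'n::{finite,linorder}) set \<Rightarrow> bool" where
  "definable S X \<longleftrightarrow> coordinates ` X \<in> S CARD('n)"

section \<open>Medial axis, tangent cone, germs\<close>

definition nearest_points :: "'a::euclidean_space set \<Rightarrow> 'a \<Rightarrow> 'a set" where
  "nearest_points X p = {x \<in> X. norm (p - x) = infdist p X}"

text \<open>Not stated through \<^const>\<open>card\<close>, which is \<open>0\<close> on infinite sets.\<close>

definition medial_axis :: "'a::euclidean_space set \<Rightarrow> 'a set" where
  "medial_axis X = {p. \<exists>x \<in> nearest_points X p. \<exists>y \<in> nearest_points X p. x \<noteq> y}"

definition tangent_cone :: "'a::euclidean_space set \<Rightarrow> 'a set" where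
  "tangent_cone E = {w. \<exists>(x :: nat \<Rightarrow> 'a) (l :: nat \<Rightarrow> real).
     (\<forall>\<nu>. x \<nu> \<in> E \<and> l \<nu> > 0) \<and> x \<longlonglongrightarrow> 0 \<and> (\<lambda>\<nu>. l \<nu> *\<^sub>R x \<nu>) \<longlonglongrightarrow> w}"

text \<open>Inclusion of the germs at the origin.\<close>

definition germ_subset :: "'a::euclidean_space set \<Rightarrow> 'a set \<Rightarrow> bool" where
  "germ_subset A B \<longleftrightarrow> (\<exists>U. open U \<and> 0 \<in> U \<and> A \<inter> U \<subseteq> B)"

definition germ_psubset :: "'a::euclidean_space set \<Rightarrow> 'a set \<Rightarrow> bool" where
  "germ_psubset A B \<longleftrightarrow> germ_subset A B \<and> \<not> germ_subset B A"

section \<open>Camber directions and directional curvature\<close>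

text \<open>The zero-based position of a coordinate.\<close>

definition position :: "'n::{finite,linorder} \<Rightarrow> nat" where
  "position i = card {j. j < i}"

definition first_coordinates_space :: "nat \<Rightarrow> (real ^ 'n::{finite,linorder}) set" where
  "first_coordinates_space k = {x. \<forall>i. position i \<ge> k \<longrightarrow> x $ i = 0}"

definition last_coordinates_space :: "nat \<Rightarrow> (real ^ 'n::{finite,linorder}) set" where
  "last_coordinates_space k = {x. \<forall>i. position i < k \<longrightarrow> x $ i = 0}"

text \<open>
  The camber directions of a set \<open>X\<close> whose tangent cone has affine hull
  \<open>first_coordinates_space k\<close>; they depend on \<open>X\<close> only through \<open>k\<close>.
\<close>

definition camber_directions :: "nat \<Rightarrow> (real ^ 'n::{finite,linorder}) set" where
  "camber_directions k = last_coordinates_space k \<inter> sphere 0 1"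

definition power_region :: "'a::euclidean_space \<Rightarrow> real \<Rightarrow> real \<Rightarrow> 'a set" where
  "power_region v \<theta> c = {z + t *\<^sub>R v | z t. orthogonal z v \<and> \<bar>t\<bar> \<le> c * norm z powr \<theta>}"

definition directional_curvature :: "'a::euclidean_space set \<Rightarrow> 'a \<Rightarrow> ereal" where
  "directional_curvature X v =
     Sup (ereal ` {\<theta>. \<theta> > 0 \<and> (\<exists>c>0. germ_subset X (power_region v \<theta> c))})"

end

theory Submission
  imports Defs
begin

text \<open>
  Write \<open>d\<close> for the distance to \<open>X\<close>. Since \<open>v\<close> is orthogonal to the tangent cone, the component of
  \<open>x \<in> X\<close> along \<open>v\<close> is \<open>o(norm x)\<close>, so a nearest point \<open>x\<close> of \<open>\<tau> v\<close> has norm \<open>o(\<tau>)\<close>. Curvature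
  below \<open>2\<close> means that, for \<open>w = v\<close> or \<open>w = -v\<close>, every ball of centre \<open>\<tau> w\<close> and radius \<open>\<tau>\<close>
  contains a point of \<open>X\<close> in its interior. If the medial axis avoided a thin open cone around \<open>w\<close>,
  then the nearest point \<open>x\<close> of \<open>\<tau> w\<close> would remain nearest along the ray from \<open>x\<close> through
  \<open>\<tau> w\<close> inside the cone. Following this ray up to a fixed height \<open>h\<close> and letting \<open>\<tau> \<rightarrow> 0\<close>
  gives \<open>d (h w) \<ge> h\<close>, a contradiction. Hence the medial axis meets every thin cone around
  \<open>w\<close> arbitrarily close to the origin.
\<close>

section \<open>Extending nearest points along rays\<close>

lemma nearest_points_iff:
  assumes "X \<noteq> {}"
  shows "x \<in> nearest_points X p \<longleftrightarrow> x \<in> X \<and> (\<forall>y\<in>X. dist p x \<le> dist p y)"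
proof
  assume "x \<in> nearest_points X p"
  then show "x \<in> X \<and> (\<forall>y\<in>X. dist p x \<le> dist p y)"
    by (auto simp: nearest_points_def dist_norm[symmetric] infdist_le)
next
  assume R: "x \<in> X \<and> (\<forall>y\<in>X. dist p x \<le> dist p y)"
  then have "dist p x \<le> infdist p X"
    using assms by (auto simp: infdist_def intro!: cINF_greatest)
  with R show "x \<in> nearest_points X p"
    by (auto simp: nearest_points_def dist_norm[symmetric] intro!: antisym infdist_le)
qed

lemma nearest_points_nonempty:
  fixes X :: "'a::euclidean_space set"
  assumes "closed X" "X \<noteq> {}"
  shows "nearest_points X p \<noteq> {}"
proof -
  obtain x where "x \<in> X" "infdist p X = dist p x"
    using infdist_attains_inf[OF assms] by blast
  then show ?thesis by (auto simp: nearest_points_def dist_norm)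
qed

text \<open>The triangle inequality is an equality along the segment, so a point of \<open>X\<close>
  closer to \<open>p\<close> than \<open>x\<close> would also be closer to \<open>q\<close>.\<close>

lemma nearest_points_segment:
  fixes X :: "'a::euclidean_space set"
  assumes "X \<noteq> {}" "x \<in> nearest_points X q" "p \<in> closed_segment x q"
  shows "x \<in> nearest_points X p"
proof -
  have d: "dist q x = dist q p + dist p x"
    using assms(3) between between_mem_segment by (metis dist_commute add.commute)
  have "dist p x \<le> dist p y" if "y \<in> X" for y
  proof -
    have "dist q x \<le> dist q y" using assms that by (simp add: nearest_points_iff)
    also have "\<dots> \<le> dist q p + dist p y" by (rule dist_triangle)
    finally show ?thesis using d by simp
  qed
  then show ?thesis using assms by (simp add: nearest_points_iff)
qed

text \<open>A closed graph argument: boundedness of \<open>S\<close> confines the nearest points to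
  a compact set, and uniqueness off the medial axis makes the graph of \<open>m\<close> the closed
  locus where the distance between the two points equals \<open>infdist\<close>.\<close>

lemma continuous_on_nearest_point:
  fixes X :: "'a::euclidean_space set"
  assumes "closed X" "X \<noteq> {}" "bounded S" "S \<inter> medial_axis X = {}"
    and m: "\<And>q. q \<in> S \<Longrightarrow> m q \<in> nearest_points X q"
  shows "continuous_on S m"
proof -
  obtain x0 where "x0 \<in> X" using assms by blast
  obtain B where B: "\<And>q. q \<in> S \<Longrightarrow> norm q \<le> B" using assms(3) by (auto simp: bounded_iff)
  \<comment> \<open>The radius comes from norm (m q) \<le> norm q + dist q x0 \<le> 2 norm q + norm
    x0.\<close>
  define T where "T = X \<inter> cball 0 (2 * B + norm x0)"
  have "compact T" unfolding T_def using assms(1) by (simp add: closed_Int_compact)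
  have "m q \<in> T" if "q \<in> S" for q
  proof -
    have "dist q (m q) \<le> dist q x0" "m q \<in> X"
      using m[OF that] \<open>x0 \<in> X\<close> assms(2) by (auto simp: nearest_points_iff)
    moreover have "norm (m q) \<le> norm q + dist q (m q)"
      by (metis dist_norm norm_minus_commute norm_triangle_sub)
    moreover have "dist q x0 \<le> norm q + norm x0" by (simp add: dist_norm norm_triangle_ineq4)
    ultimately show ?thesis using B[OF that] by (auto simp: T_def)
  qed
  then have "m \<in> S \<rightarrow> T" by blast
  have "Pair q (m q) \<in> {z. dist (fst z) (snd z) = infdist (fst z) X}" if "q \<in> S" for q
    using m[OF that] by (auto simp: nearest_points_def dist_norm)
  moreover have "x = m q" if "q \<in> S" "x \<in> T" "dist q x = infdist q X" for q x
  proof -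
    have "x \<in> nearest_points X q"
      using that by (auto simp: nearest_points_def dist_norm T_def)
    then show ?thesis using m[OF that(1)] assms(4) that(1) by (auto simp: medial_axis_def)
  qed
  ultimately have
    "(\<lambda>q. Pair q (m q)) ` S = (S \<times> T) \<inter> {z. dist (fst z) (snd z) = infdist (fst z) X}"
    using \<open>m \<in> S \<rightarrow> T\<close> by fastforce
  moreover have "closed {z::'a \<times> 'a. dist (fst z) (snd z) = infdist (fst z) X}"
    by (intro closed_Collect_eq continuous_intros)
  ultimately have "closedin (top_of_set (S \<times> T)) ((\<lambda>q. Pair q (m q)) ` S)"
    by (simp add: closedin_closed_Int)
  then show ?thesis
    using continuous_closed_graph_eq[OF \<open>compact T\<close> \<open>m \<in> S \<rightarrow> T\<close>] by simp
qed

text \<open>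
  A fixed point \<open>q\<close> of \<open>q \<mapsto> p + s (q - m q) / d q\<close>, where \<open>m q\<close> is the nearest point of \<open>q\<close>,
  lies on the ray from \<open>m q\<close> through \<open>p\<close>; Brouwer's theorem replaces the gradient flow of the
  distance function.
\<close>

lemma nearest_point_extend_local:
  fixes X :: "'a::euclidean_space set"
  assumes "closed X" "x \<in> nearest_points X p" "p \<noteq> x" "open U" "p \<in> U" "U \<inter> medial_axis X = {}"
  obtains s where "s > 0"
    and "\<And>r. 0 < r \<Longrightarrow> r \<le> s \<Longrightarrow> x \<in> nearest_points X (p + (r / dist p x) *\<^sub>R (p - x))"
proof -
  have X: "X \<noteq> {}" using assms(2) by (auto simp: nearest_points_def)
  have dx: "infdist p X = dist p x" using assms(2) by (auto simp: nearest_points_def dist_norm)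
  obtain e where e: "e > 0" "cball p e \<subseteq> U" using assms open_contains_cball by blast
  \<comment> \<open>The bound \<open>e\<close> keeps the ball inside \<open>U\<close>. The third
    gives dist q (m q) \<ge> 2 r on the ball of radius \<open>r\<close>, so the denominator in
    \<open>F\<close> does not vanish and r / d < 1 below.\<close>
  define s where "s = min e (dist p x / 3)"
  show ?thesis
  proof
    show "s > 0" using e assms(3) by (simp add: s_def)
    fix r :: real assume r: "0 < r" "r \<le> s"
    have sub: "cball p r \<subseteq> U" using e r by (auto simp: s_def)
    define m where "m q = (SOME x. x \<in> nearest_points X q)" for q
    have m: "m q \<in> nearest_points X q" for q
      unfolding m_def using nearest_points_nonempty[OF assms(1) X] by (simp add: some_in_eq)
    have cont: "continuous_on (cball p r) m"
      by (rule continuous_on_nearest_point[OF assms(1) X]) (use sub assms(6) m in auto)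
    have far: "r < dist q (m q)" if "q \<in> cball p r" for q
    proof -
      have "dist p x \<le> dist p (m q)"
        using assms(2) m[of q] X by (simp add: nearest_points_iff)
      also have "\<dots> \<le> dist p q + dist q (m q)" by (rule dist_triangle)
      finally show ?thesis using that r assms(3) by (simp add: s_def)
    qed
    define F where "F q = p + (r / dist q (m q)) *\<^sub>R (q - m q)" for q
    have "continuous_on (cball p r) F"
      unfolding F_def using far r by (intro continuous_intros cont) fastforce
    moreover have "F \<in> cball p r \<rightarrow> cball p r"
      using r by (auto simp: F_def dist_norm)
    ultimately obtain q where q: "q \<in> cball p r" "F q = q"
      using brouwer[of "cball p r" F] r by auto
    define d where "d = dist q (m q)"
    have d: "r < d" using far[OF q(1)] by (simp add: d_def)
    have qF: "q = p + (r / d) *\<^sub>R (q - m q)" using q(2) by (simp add: F_def d_def)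
    have pe: "p = (r / d) *\<^sub>R m q + (1 - r / d) *\<^sub>R q"
      using arg_cong[OF qF, of "\<lambda>y. y - (r / d) *\<^sub>R (q - m q)"] by (simp add: algebra_simps)
    \<comment> \<open>Solved for \<open>p\<close>, the fixed point equation is a convex combination.
      Hence \<open>m q\<close> is also nearest to \<open>p\<close>, and as \<open>p\<close> is off
      the medial axis, it must be \<open>x\<close>.\<close>
    have "p \<in> closed_segment q (m q)"
      unfolding closed_segment_def using r d pe
      by (auto intro!: exI[of _ "r / d"] simp: add.commute)
    then have "m q \<in> nearest_points X p"
      using nearest_points_segment[OF X m] by (simp add: closed_segment_commute)
    then have mx: "m q = x"
      using assms(2,5,6) by (auto simp: medial_axis_def)
    have px: "p - x = (1 - r / d) *\<^sub>R (q - x)"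
      using pe mx by (simp add: algebra_simps)
    moreover have "0 < 1 - r / d" using r d by simp
    ultimately have "dist p x = (1 - r / d) * d"
      using mx by (simp add: dist_norm d_def)
    then have "(r / dist p x) *\<^sub>R (p - x) = (r / d) *\<^sub>R (q - x)"
      using px r d by simp
    then have "q = p + (r / dist p x) *\<^sub>R (p - x)" using qF mx by simp
    then show "x \<in> nearest_points X (p + (r / dist p x) *\<^sub>R (p - x))" using m[of q] mx by simp
  qed
qed

text \<open>Continuation along the ray: the admissible parameters form a compact set containing 1,
  and the local extension shows that its maximum cannot lie below \<open>b\<close>.\<close>

lemma nearest_point_extend:
  fixes X :: "'a::euclidean_space set"
  assumes "closed X" "x \<in> nearest_points X p" "p \<noteq> x" "open U" "U \<inter> medial_axis X = {}"
    and "1 \<le> b" and ray: "\<And>a. 1 \<le> a \<Longrightarrow> a \<le> b \<Longrightarrow> x + a *\<^sub>R (p - x) \<in> U"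
  shows "x \<in> nearest_points X (x + b *\<^sub>R (p - x))"
proof -
  define A where "A = {a \<in> {1..b}. dist (x + a *\<^sub>R (p - x)) x = infdist (x + a *\<^sub>R (p - x)) X}"
  have xX: "x \<in> X" using assms(2) by (simp add: nearest_points_def)
  have A_iff: "a \<in> A \<longleftrightarrow> 1 \<le> a \<and> a \<le> b \<and> x \<in> nearest_points X (x + a *\<^sub>R (p - x))" for a
    using xX by (auto simp: A_def nearest_points_def dist_norm)
  have "closed {a::real. dist (x + a *\<^sub>R (p - x)) x = infdist (x + a *\<^sub>R (p - x)) X}"
    by (intro closed_Collect_eq continuous_intros)
  then have "compact ({1..b} \<inter> {a. dist (x + a *\<^sub>R (p - x)) x = infdist (x + a *\<^sub>R (p - x)) X})"
    by (intro compact_Int_closed compact_Icc)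
  then have "compact A" by (simp add: A_def Int_def)
  moreover have "1 \<in> A" using assms(2,6) by (simp add: A_iff)
  ultimately obtain c where c: "c \<in> A" "\<And>a. a \<in> A \<Longrightarrow> a \<le> c"
    using compact_attains_sup[of A] by blast
  have "c = b"
  proof (rule ccontr)
    assume "c \<noteq> b"
    then have cb: "1 \<le> c" "c < b" using c by (auto simp: A_iff)
    let ?p = "x + c *\<^sub>R (p - x)"
    have n: "dist ?p x = c * dist p x" using cb by (simp add: dist_norm)
    have np: "norm (p - x) > 0" using assms(3) by simp
    obtain s where s: "s > 0"
      "\<And>r. 0 < r \<Longrightarrow> r \<le> s \<Longrightarrow> x \<in> nearest_points X (?p + (r / dist ?p x) *\<^sub>R (?p - x))"
      using nearest_point_extend_local[OF assms(1), of x ?p U] c(1) assms(3-5) ray[of c] cb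
      by (auto simp: A_iff)
    \<comment> \<open>Moving by \<open>r\<close> raises the parameter by r / norm (p - x); the
      second bound keeps it at most \<open>b\<close>.\<close>
    define r where "r = min s ((b - c) * norm (p - x))"
    have r: "0 < r" "r \<le> s" using s cb np by (auto simp: r_def)
    have "?p + (r / dist ?p x) *\<^sub>R (?p - x) = x + (c + r / norm (p - x)) *\<^sub>R (p - x)"
      using cb np by (simp add: n dist_norm scaleR_add_left)
    then have "x \<in> nearest_points X (x + (c + r / norm (p - x)) *\<^sub>R (p - x))"
      using s(2)[OF r] by metis
    moreover have "r / norm (p - x) \<le> b - c"
      using np by (simp add: r_def divide_le_eq)
    moreover have "r / norm (p - x) > 0" using r np by simp
    ultimately have "c + r / norm (p - x) \<in> A" using cb by (simp add: A_iff)
    then show False using c(2) \<open>r / norm (p - x) > 0\<close> by fastforce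
  qed
  then show ?thesis using c(1) by (simp add: A_iff)
qed

section \<open>The medial axis in thin cones\<close>

lemma norm_scaled_unit_diff_squared:
  fixes w x :: "'a::real_inner"
  assumes "norm w = 1"
  shows "(norm (\<tau> *\<^sub>R w - x))\<^sup>2 = \<tau>\<^sup>2 - 2 * \<tau> * (x \<bullet> w) + (norm x)\<^sup>2"
proof -
  have "w \<bullet> w = 1" using assms by (simp add: dot_square_norm)
  then show ?thesis
    unfolding power2_norm_eq_inner
    by (simp add: inner_diff inner_commute power2_eq_square algebra_simps)
qed

text \<open>\<open>flat\<close> makes the nearest points of \<tau> w small compared with \<tau>, so
  the rays leaving them stay in the cone; \<open>close\<close> at one fixed height \<open>h\<close>
  then yields the contradiction.\<close>

lemma medial_axis_meets_cone:
  fixes X :: "'a::euclidean_space set"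
  assumes "closed X" "0 \<in> X" "norm w = 1"
    and flat: "\<And>\<eta>. \<eta> > 0 \<Longrightarrow> \<exists>r>0. \<forall>x\<in>X. norm x < r \<longrightarrow> \<bar>x \<bullet> w\<bar> \<le> \<eta> * norm x"
    and close: "\<And>\<tau>. \<tau> > 0 \<Longrightarrow> infdist (\<tau> *\<^sub>R w) X < \<tau>"
    and "\<delta> > 0" "\<epsilon> > 0"
  obtains t p where "0 < t" "t < \<epsilon>" "p \<in> medial_axis X" "dist p (t *\<^sub>R w) < \<delta> * t"
proof (rule ccontr)
  assume "\<not> thesis"
  note none = that[THEN notE[OF this]]
  define U where "U = (\<Union>t\<in>{0<..<\<epsilon>}. ball (t *\<^sub>R w) (\<delta> * t))"
  have "open U" by (auto simp: U_def)
  have "U \<inter> medial_axis X = {}"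
    using none by (auto simp: U_def dist_commute)
  define h where "h = \<epsilon> / 2"
  have h: "0 < h" "h < \<epsilon>" using assms(7) by (auto simp: h_def)
  \<comment> \<open>In place of a limit in \<tau>, the relative deviation \<rho> of the ray from the
    axis is fixed first and \<tau> is chosen from it.\<close>
  have key: "h * (1 - 2 * \<rho>) \<le> infdist (h *\<^sub>R w) X" if \<rho>: "0 < \<rho>" "\<rho> < 1" "\<rho> < \<delta>" for \<rho>
  proof -
    obtain r where r: "r > 0" "\<forall>x\<in>X. norm x < r \<longrightarrow> \<bar>x \<bullet> w\<bar> \<le> \<rho> / 2 * norm x"
      using flat[of "\<rho> / 2"] \<rho> by auto
    \<comment> \<open>The bound r / 3 suffices because norm x < 2 \<tau>; the bound \<open>h\<close>
      makes the stretching factor \<open>b\<close> at least 1.\<close>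
    define \<tau> where "\<tau> = min h (r / 3)"
    have \<tau>: "0 < \<tau>" "\<tau> \<le> h" "3 * \<tau> \<le> r" using h r by (auto simp: \<tau>_def)
    obtain x where x: "x \<in> nearest_points X (\<tau> *\<^sub>R w)"
      using nearest_points_nonempty[OF assms(1)] assms(2) by blast
    then have xX: "x \<in> X" and dx: "norm (\<tau> *\<^sub>R w - x) < \<tau>"
      using close[OF \<tau>(1)] by (auto simp: nearest_points_def)
    have "norm x \<le> norm (\<tau> *\<^sub>R w) + norm (\<tau> *\<^sub>R w - x)"
      by (metis norm_minus_commute norm_triangle_sub)
    then have "norm x < r" using dx \<tau> assms(3) by simp
    then have xw: "x \<bullet> w \<le> \<rho> / 2 * norm x" using r xX by fastforce
    \<comment> \<open>Expanding the square bounds the squared norm of \<open>x\<close> by 2 \<tau>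
      times its component along \<open>w\<close>. Flatness with constant \<rho> / 2 then lets one
      factor norm x cancel.\<close>
    have "(norm (\<tau> *\<^sub>R w - x))\<^sup>2 \<le> \<tau>\<^sup>2" using dx by (intro power_mono) auto
    moreover have "(norm (\<tau> *\<^sub>R w - x))\<^sup>2 = \<tau>\<^sup>2 - 2 * \<tau> * (x \<bullet> w) + (norm x)\<^sup>2"
      using assms(3) by (rule norm_scaled_unit_diff_squared)
    ultimately have "(norm x)\<^sup>2 \<le> 2 * \<tau> * (x \<bullet> w)" by simp
    also have "\<dots> \<le> 2 * \<tau> * (\<rho> / 2 * norm x)" using xw \<tau> by (intro mult_left_mono) auto
    finally have "norm x * norm x \<le> \<rho> * \<tau> * norm x" by (simp add: power2_eq_square algebra_simps)
    then have nx: "norm x \<le> \<rho> * \<tau>"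
      using \<rho> \<tau> by (cases "norm x = 0") auto
    \<comment> \<open>The factor that stretches \<tau> w to h w.\<close>
    define b where "b = h / \<tau>"
    have b: "1 \<le> b" "b * \<tau> = h" using \<tau> by (auto simp: b_def)
    have off: "norm (x + a *\<^sub>R (\<tau> *\<^sub>R w - x) - (a * \<tau>) *\<^sub>R w) \<le> \<rho> * (a * \<tau>)" if "1 \<le> a" for a
    proof -
      have "x + a *\<^sub>R (\<tau> *\<^sub>R w - x) - (a * \<tau>) *\<^sub>R w = (1 - a) *\<^sub>R x" by (simp add: algebra_simps)
      then have "norm (x + a *\<^sub>R (\<tau> *\<^sub>R w - x) - (a * \<tau>) *\<^sub>R w) = (a - 1) * norm x"
        using that by simp
      also have "\<dots> \<le> a * norm x" by (simp add: mult_right_mono)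
      also have "\<dots> \<le> a * (\<rho> * \<tau>)" using nx that by (intro mult_left_mono) auto
      finally show ?thesis by (simp add: algebra_simps)
    qed
    have low: "\<tau> * (1 - \<rho>) \<le> norm (\<tau> *\<^sub>R w - x)"
      using norm_triangle_ineq2[of "\<tau> *\<^sub>R w" x] nx \<tau> assms(3) by (simp add: algebra_simps)
    have ne: "\<tau> *\<^sub>R w \<noteq> x"
    proof
      assume "\<tau> *\<^sub>R w = x"
      then have "\<tau> * (1 - \<rho>) \<le> 0" using low by simp
      then show False using \<tau> \<rho> by (simp add: mult_le_0_iff)
    qed
    have "x + a *\<^sub>R (\<tau> *\<^sub>R w - x) \<in> U" if a: "1 \<le> a" "a \<le> b" for a
    proof -
      have "a * \<tau> \<le> h" using a(2) \<tau>(1) b(2) by (metis less_imp_le mult_right_mono)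
      moreover have "0 < a * \<tau>" using a \<tau> by simp
      moreover from this have "\<rho> * (a * \<tau>) < \<delta> * (a * \<tau>)" using \<rho> by (intro mult_strict_right_mono)
      ultimately show ?thesis
        using off[OF a(1)] h unfolding U_def
        by (intro UN_I[of "a * \<tau>"]) (auto simp: dist_norm norm_minus_commute)
    qed
    then have q: "x \<in> nearest_points X (x + b *\<^sub>R (\<tau> *\<^sub>R w - x))" (is "x \<in> nearest_points X ?q")
      using nearest_point_extend[OF assms(1) x ne \<open>open U\<close> \<open>U \<inter> medial_axis X = {}\<close> b(1)] by blast
    \<comment> \<open>One \<rho> h is lost because \<open>x\<close> is not the origin, another
      because \<open>?q\<close> is only near h w.\<close>
    have "h * (1 - \<rho>) = b * (\<tau> * (1 - \<rho>))" using b(2) by (metis mult.assoc)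
    also have "\<dots> \<le> b * norm (\<tau> *\<^sub>R w - x)" using low b by (intro mult_left_mono) auto
    also have "\<dots> = norm (?q - x)" using b(1) by simp
    also have "\<dots> = infdist ?q X" using q unfolding nearest_points_def by blast
    also have "\<dots> \<le> infdist (h *\<^sub>R w) X + dist ?q (h *\<^sub>R w)" by (rule infdist_triangle)
    also have "dist ?q (h *\<^sub>R w) \<le> \<rho> * h" using off[OF b(1)] b(2) by (simp add: dist_norm)
    finally show ?thesis by (simp add: algebra_simps)
  qed
  define g where "g = infdist (h *\<^sub>R w) X"
  have g: "0 \<le> g" "g < h" using close[OF h(1)] by (auto simp: g_def infdist_nonneg)
  \<comment> \<open>With 2 \<rho> h \<le> (h - g) / 2 the lower bound is at least (h + g) / 2, which
    exceeds \<open>g\<close>.\<close>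
  define \<rho> where "\<rho> = min ((h - g) / (4 * h)) (\<delta> / 2)"
  have "0 < \<rho>" "\<rho> < \<delta>" using g h assms(6) by (auto simp: \<rho>_def)
  moreover have \<rho>: "\<rho> \<le> (h - g) / (4 * h)" by (simp add: \<rho>_def)
  moreover have "(h - g) / (4 * h) < 1" using g h by (simp add: divide_less_eq)
  ultimately have "h * (1 - 2 * \<rho>) \<le> g" using key[of \<rho>] by (simp add: g_def)
  moreover have "\<rho> * h \<le> (h - g) / 4" using \<rho> h by (simp add: field_simps)
  ultimately show False using g by (simp add: algebra_simps)
qed

section \<open>Tangent cones as limits of rescaled points\<close>

lemma tangent_cone_of_thin_cones:
  assumes "\<And>\<delta> \<epsilon>. \<delta> > 0 \<Longrightarrow> \<epsilon> > 0 \<Longrightarrow>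
      \<exists>t p. 0 < t \<and> t < \<epsilon> \<and> p \<in> E \<and> dist p (t *\<^sub>R w) < \<delta> * t"
  shows "w \<in> tangent_cone E"
proof -
  have "\<forall>n::nat. \<exists>t p. 0 < t \<and> t < inverse (Suc n) \<and> p \<in> E \<and> dist p (t *\<^sub>R w) < inverse (Suc n) * t"
    using assms by simp
  then obtain t p where tp: "\<And>n::nat. 0 < t n" "\<And>n. t n < inverse (Suc n)" "\<And>n. p n \<in> E"
      "\<And>n. dist (p n) (t n *\<^sub>R w) < inverse (Suc n) * t n"
    by metis
  have inv0: "(\<lambda>n. inverse (real (Suc n))) \<longlonglongrightarrow> 0" by (rule LIMSEQ_inverse_real_of_nat)
  \<comment> \<open>Dividing by \<open>t n\<close> turns the aperture of the cone into the distance
    to \<open>w\<close>.\<close>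
  have "norm (inverse (t n) *\<^sub>R p n - w) \<le> inverse (Suc n)" for n
  proof -
    have "inverse (t n) *\<^sub>R p n - w = inverse (t n) *\<^sub>R (p n - t n *\<^sub>R w)"
      using tp(1)[of n] by (simp add: algebra_simps)
    then have "norm (inverse (t n) *\<^sub>R p n - w) = dist (p n) (t n *\<^sub>R w) / t n"
      using tp(1)[of n] by (simp add: dist_norm divide_inverse mult.commute)
    then show ?thesis using tp(1,4)[of n] by (simp add: divide_le_eq)
  qed
  then have lim: "(\<lambda>n. inverse (t n) *\<^sub>R p n) \<longlonglongrightarrow> w"
    by (intro LIM_zero_cancel[OF Lim_null_comparison[OF _ inv0]]) auto
  have "t \<longlonglongrightarrow> 0"
    by (rule Lim_null_comparison[OF _ inv0]) (use tp(1,2) in \<open>auto simp: less_imp_le abs_of_pos\<close>)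
  then have "(\<lambda>n. t n *\<^sub>R (inverse (t n) *\<^sub>R p n)) \<longlonglongrightarrow> 0 *\<^sub>R w"
    using lim by (intro tendsto_intros)
  moreover have "t n *\<^sub>R (inverse (t n) *\<^sub>R p n) = p n" for n
    using tp(1)[of n] by simp
  ultimately have "p \<longlonglongrightarrow> 0" by simp
  then show ?thesis
    unfolding tangent_cone_def using tp(1,3) lim
    by (intro CollectI exI[of _ p] exI[of _ "\<lambda>n. inverse (t n)"]) auto
qed

text \<open>Supplies the second point, besides \<open>w\<close>, for the lower bound on the affine
  dimension.\<close>

lemma zero_in_tangent_cone:
  assumes "w \<in> tangent_cone E"
  shows "0 \<in> tangent_cone E"
proof -
  obtain x l where xl: "\<forall>n::nat. x n \<in> E \<and> l n > (0::real)" "x \<longlonglongrightarrow> 0"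
    using assms by (auto simp: tangent_cone_def)
  then show ?thesis
    unfolding tangent_cone_def
    by (intro CollectI exI[of _ x] exI[of _ "\<lambda>_. 1"]) auto
qed

text \<open>By compactness of the sphere, normalised violating points would accumulate at a tangent
  vector whose component along \<open>v\<close> is at least \<eta> in absolute value.\<close>

lemma tangent_cone_orthogonal_imp_flat:
  fixes X :: "'a::euclidean_space set"
  assumes "\<And>u. u \<in> tangent_cone X \<Longrightarrow> u \<bullet> v = 0" "\<eta> > 0"
  shows "\<exists>r>0. \<forall>x\<in>X. norm x < r \<longrightarrow> \<bar>x \<bullet> v\<bar> \<le> \<eta> * norm x"
proof (rule ccontr)
  assume "\<not> ?thesis"
  then have "\<forall>n::nat. \<exists>x\<in>X. norm x < inverse (Suc n) \<and> \<eta> * norm x < \<bar>x \<bullet> v\<bar>"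
    by (metis inverse_positive_iff_positive not_le of_nat_0_less_iff zero_less_Suc)
  then obtain x where x: "\<And>n::nat. x n \<in> X" "\<And>n. norm (x n) < inverse (Suc n)"
      "\<And>n. \<eta> * norm (x n) < \<bar>x n \<bullet> v\<bar>"
    by metis
  have nz: "norm (x n) > 0" for n using x(3)[of n] by auto
  define y where "y n = inverse (norm (x n)) *\<^sub>R x n" for n
  have "\<forall>n. y n \<in> sphere 0 1" using nz by (simp add: y_def)
  then obtain u s where u: "strict_mono s" "(y \<circ> s) \<longlonglongrightarrow> u"
    using compact_sphere[of "0::'a" 1] unfolding compact_def by blast
  have "x \<longlonglongrightarrow> 0"
    by (rule Lim_null_comparison[OF _ LIMSEQ_inverse_real_of_nat])
      (use x(2) in \<open>auto intro!: always_eventually less_imp_le\<close>)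
  then have "(x \<circ> s) \<longlonglongrightarrow> 0" using u(1) by (rule LIMSEQ_subseq_LIMSEQ)
  then have "u \<in> tangent_cone X"
    unfolding tangent_cone_def using x(1) nz u(2)
    by (intro CollectI exI[of _ "x \<circ> s"] exI[of _ "\<lambda>n. inverse (norm (x (s n)))"])
      (auto simp: y_def o_def)
  then have "u \<bullet> v = 0" by (rule assms(1))
  moreover have "(\<lambda>n. \<bar>(y \<circ> s) n \<bullet> v\<bar>) \<longlonglongrightarrow> \<bar>u \<bullet> v\<bar>" using u(2) by (intro tendsto_intros)
  moreover have "\<eta> \<le> \<bar>(y \<circ> s) n \<bullet> v\<bar>" for n
    using x(3)[of "s n"] nz[of "s n"] by (simp add: y_def abs_mult field_simps)
  ultimately have "\<eta> \<le> 0" using LIMSEQ_le_const[of _ _ \<eta>] by fastforce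
  then show False using assms(2) by simp
qed

section \<open>Directional curvature and power regions\<close>

lemma power_region_iff:
  assumes "norm v = 1"
  shows "x \<in> power_region v \<theta> c \<longleftrightarrow> \<bar>x \<bullet> v\<bar> \<le> c * norm (x - (x \<bullet> v) *\<^sub>R v) powr \<theta>"
proof -
  have vv: "v \<bullet> v = 1" using assms by (simp add: dot_square_norm)
  show ?thesis
  proof
    assume "x \<in> power_region v \<theta> c"
    then obtain z t where "x = z + t *\<^sub>R v" "z \<bullet> v = 0" "\<bar>t\<bar> \<le> c * norm z powr \<theta>"
      by (auto simp: power_region_def orthogonal_def)
    then show "\<bar>x \<bullet> v\<bar> \<le> c * norm (x - (x \<bullet> v) *\<^sub>R v) powr \<theta>"
      by (simp add: inner_add_left vv)
  next
    assume "\<bar>x \<bullet> v\<bar> \<le> c * norm (x - (x \<bullet> v) *\<^sub>R v) powr \<theta>"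
    then show "x \<in> power_region v \<theta> c"
      unfolding power_region_def
      by (intro CollectI exI[of _ "x - (x \<bullet> v) *\<^sub>R v"] exI[of _ "x \<bullet> v"])
        (auto simp: orthogonal_def inner_diff_left vv)
  qed
qed

text \<open>If the component along \<open>v\<close> is at most half the norm, the orthogonal
  component has at least the other half, so the exponent 1 is admissible with constant 1.\<close>

lemma one_le_directional_curvature:
  assumes "norm v = 1"
    and "\<exists>r>0. \<forall>x\<in>X. norm x < r \<longrightarrow> \<bar>x \<bullet> v\<bar> \<le> 1 / 2 * norm x"
  shows "1 \<le> directional_curvature X v"
proof -
  obtain r where r: "r > 0" "\<forall>x\<in>X. norm x < r \<longrightarrow> \<bar>x \<bullet> v\<bar> \<le> 1 / 2 * norm x"
    using assms(2) by blast
  have "x \<in> power_region v 1 1" if "x \<in> X" "norm x < r" for x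
  proof -
    have "norm x \<le> norm (x - (x \<bullet> v) *\<^sub>R v) + norm ((x \<bullet> v) *\<^sub>R v)"
      by (metis diff_add_cancel norm_triangle_ineq)
    moreover have "\<bar>x \<bullet> v\<bar> \<le> 1 / 2 * norm x" using r that by blast
    ultimately show ?thesis using assms(1) by (simp add: power_region_iff)
  qed
  then have "germ_subset X (power_region v 1 1)"
    unfolding germ_subset_def using r(1) by (intro exI[of _ "ball 0 r"]) auto
  then show ?thesis
    unfolding directional_curvature_def
    by (intro Sup_upper image_eqI[of _ _ 1]) (auto intro: exI[of _ 1] simp: one_ereal_def)
qed

text \<open>The exponent 2 lies above the supremum, so \<open>X\<close> leaves every quadratic
  region in every neighbourhood of the origin. The side of the exit might depend on \<open>c\<close>
  and \<open>r\<close>; the point is to choose one side for all of them.\<close>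

lemma directional_curvature_less_two_exit:
  fixes X :: "'a::euclidean_space set"
  assumes "norm v = 1" "directional_curvature X v < 2"
  obtains w where "w = v \<or> w = - v"
    and "\<And>c r. c > 0 \<Longrightarrow> r > 0 \<Longrightarrow>
      \<exists>x\<in>X. norm x < r \<and> c * (norm (x - (x \<bullet> w) *\<^sub>R w))\<^sup>2 < x \<bullet> w"
proof -
  define P where
    "P w c r \<longleftrightarrow> (\<exists>x\<in>X. norm x < r \<and> c * (norm (x - (x \<bullet> w) *\<^sub>R w))\<^sup>2 < x \<bullet> w)" for w c r
  have leave: "P v c r \<or> P (- v) c r" if "c > 0" "r > 0" for c r
  proof -
    have "\<not> germ_subset X (power_region v 2 c)"
    proof
      assume "germ_subset X (power_region v 2 c)"
      then have "ereal 2 \<le> directional_curvature X v"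
        unfolding directional_curvature_def using that by (intro Sup_upper imageI) auto
      then show False using assms(2) by auto
    qed
    then have "\<not> X \<inter> ball 0 r \<subseteq> power_region v 2 c"
      unfolding germ_subset_def using that by (metis centre_in_ball open_ball)
    then obtain x where "x \<in> X" "x \<in> ball 0 r" "x \<notin> power_region v 2 c" by blast
    then have "norm x < r" by simp
    have "c * (norm (x - (x \<bullet> v) *\<^sub>R v))\<^sup>2 < \<bar>x \<bullet> v\<bar>"
      using \<open>x \<notin> power_region v 2 c\<close> assms(1) by (simp add: power_region_iff)
    with \<open>x \<in> X\<close> \<open>norm x < r\<close> show ?thesis
      by (cases "x \<bullet> v \<ge> 0") (auto simp: P_def intro!: bexI[of _ x])
  qed
  have mono: "P w c' r'" if "P w c r" "c' \<le> c" "r \<le> r'" for w c r c' r'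
  proof -
    obtain x where x: "x \<in> X" "norm x < r" "c * (norm (x - (x \<bullet> w) *\<^sub>R w))\<^sup>2 < x \<bullet> w"
      using \<open>P w c r\<close> by (auto simp: P_def)
    have "c' * (norm (x - (x \<bullet> w) *\<^sub>R w))\<^sup>2 \<le> c * (norm (x - (x \<bullet> w) *\<^sub>R w))\<^sup>2"
      using that(2) by (intro mult_right_mono) auto
    then show ?thesis unfolding P_def using x that(3) by (intro bexI[of _ x]) auto
  qed
  \<comment> \<open>Exits are inherited by smaller constants and larger radii. If each side failed
    once, both would fail at the larger constant and the smaller radius.\<close>
  have "(\<forall>c>0. \<forall>r>0. P v c r) \<or> (\<forall>c>0. \<forall>r>0. P (- v) c r)"
  proof (rule ccontr)
    assume "\<not> ?thesis"
    then obtain c r c' r' where *: "c > 0" "r > 0" "\<not> P v c r" "c' > 0" "r' > 0" "\<not> P (- v) c' r'"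
      by blast
    then have "P v (max c c') (min r r') \<or> P (- v) (max c c') (min r r')"
      by (intro leave) auto
    then show False using * mono by (meson max.cobounded1 max.cobounded2 min.cobounded1 min.cobounded2)
  qed
  then show ?thesis using that[of v] that[of "- v"] unfolding P_def by blast
qed

text \<open>With a = x \<bullet> w, both the squared orthogonal component and the square of a are
  below \<tau> a. Their sum is below 2 \<tau> a, which places \<open>x\<close> strictly inside the
  ball of radius \<tau> about \<tau> w.\<close>

lemma infdist_less_of_quadratic_exit:
  fixes X :: "'a::euclidean_space set"
  assumes "norm w = 1" "\<tau> > 0" "x \<in> X" "norm x < \<tau>"
    and "inverse \<tau> * (norm (x - (x \<bullet> w) *\<^sub>R w))\<^sup>2 < x \<bullet> w"
  shows "infdist (\<tau> *\<^sub>R w) X < \<tau>"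
proof -
  have ww: "w \<bullet> w = 1" using assms by (simp add: dot_square_norm)
  have t0: "0 < x \<bullet> w"
    using assms(2,5) by (smt (verit) mult_nonneg_nonneg inverse_nonnegative_iff_nonnegative zero_le_power2)
  have "x \<bullet> w < \<tau>" using Cauchy_Schwarz_ineq2[of x w] assms by simp
  then have "(x \<bullet> w)\<^sup>2 < \<tau> * (x \<bullet> w)" using t0 by (simp add: power2_eq_square)
  moreover have "(norm (x - (x \<bullet> w) *\<^sub>R w))\<^sup>2 < \<tau> * (x \<bullet> w)"
    using assms(2,5) by (simp add: field_simps)
  moreover have "(norm (x - (x \<bullet> w) *\<^sub>R w))\<^sup>2 = (norm x)\<^sup>2 - (x \<bullet> w)\<^sup>2"
    unfolding power2_norm_eq_inner
    by (simp add: inner_diff inner_commute ww power2_eq_square algebra_simps)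
  moreover have "(norm (\<tau> *\<^sub>R w - x))\<^sup>2 = \<tau>\<^sup>2 - 2 * \<tau> * (x \<bullet> w) + (norm x)\<^sup>2"
    using assms(1) by (rule norm_scaled_unit_diff_squared)
  ultimately have "(norm (\<tau> *\<^sub>R w - x))\<^sup>2 < \<tau>\<^sup>2" by simp
  then have "norm (\<tau> *\<^sub>R w - x) < \<tau>" using assms(2) by (simp add: power2_less_imp_less)
  then show ?thesis using infdist_le[OF assms(3), of "\<tau> *\<^sub>R w"] by (simp add: dist_norm)
qed

text \<open>In this cone the component along \<open>v\<close> exceeds 3 t / 4 in absolute value
  while the orthogonal component is shorter than t / 2.\<close>

lemma cone_subset_power_region_complement:
  fixes v w p :: "'a::euclidean_space"
  assumes "norm v = 1" "w = v \<or> w = - v" "1 \<le> \<theta>" "0 < t" "t < 1" "dist p (t *\<^sub>R w) < 1 / 4 * t"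
  shows "p \<notin> power_region v \<theta> 1"
proof -
  define y where "y = p - t *\<^sub>R w"
  have vv: "v \<bullet> v = 1" using assms by (simp add: dot_square_norm)
  have y: "norm y < 1 / 4 * t" using assms(6) by (simp add: y_def dist_norm)
  have yv: "\<bar>y \<bullet> v\<bar> \<le> norm y" using Cauchy_Schwarz_ineq2[of y v] assms(1) by simp
  have pv: "p \<bullet> v = y \<bullet> v + t * (w \<bullet> v)" by (simp add: y_def inner_diff_left)
  have "p - (p \<bullet> v) *\<^sub>R v = y - (y \<bullet> v) *\<^sub>R v"
    using assms(2) by (auto simp: y_def inner_diff_left vv algebra_simps)
  then have z: "norm (p - (p \<bullet> v) *\<^sub>R v) \<le> 2 * norm y"
    using norm_triangle_ineq4[of y "(y \<bullet> v) *\<^sub>R v"] yv assms(1) by simp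
  \<comment> \<open>The orthogonal component has norm below 1, so raising the exponent from 1 to
    \<theta> can only decrease the power.\<close>
  have "norm (p - (p \<bullet> v) *\<^sub>R v) powr \<theta> \<le> norm (p - (p \<bullet> v) *\<^sub>R v) powr 1"
    using z y assms by (intro powr_mono') auto
  moreover have "\<bar>p \<bullet> v\<bar> \<ge> t - norm y" using pv yv assms(2) vv by auto
  ultimately show ?thesis using z y assms(1) by (simp add: power_region_iff)
qed

section \<open>Camber directions and the conclusion\<close>

lemma camber_direction_orthogonal:
  fixes u v :: "real ^ 'n::{finite,linorder}"
  assumes "u \<in> first_coordinates_space k" "v \<in> camber_directions k"
  shows "u \<bullet> v = 0"
proof -
  have "u $ i * v $ i = 0" for i
    using assms by (cases "position i < k")
      (auto simp: first_coordinates_space_def camber_directions_def last_coordinates_space_def)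
  then show ?thesis unfolding inner_vec_def by (intro sum.neutral) (simp del: mult_eq_0_iff)
qed

theorem theorem5p5:
  fixes S :: "nat \<Rightarrow> real list set set"
    and X :: "(real ^ 'n::{finite,linorder}) set"
    and k :: nat
    and v :: "real ^ 'n::{finite,linorder}"
  assumes "polynomially_bounded_o_minimal_structure S"
    and "closed X" and "definable S X" and "0 \<in> X"
    and "germ_psubset X UNIV"
    and "1 \<le> k" and "k < CARD('n)"
    and "affine hull (tangent_cone X) = first_coordinates_space k"
    and "v \<in> camber_directions k"
    and "directional_curvature X v < 2"
  shows "0 \<in> closure (medial_axis X)
    \<and> (\<exists>C>0. 0 \<in> closure (medial_axis X \<inter>
          {z + t *\<^sub>R v | z t. orthogonal z v \<and>
             \<bar>t\<bar> > C * norm z powr real_of_ereal (directional_curvature X v)}))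
    \<and> aff_dim (tangent_cone (medial_axis X) \<inter> span {v}) = 1
    \<and> (v \<in> tangent_cone (medial_axis X) \<or> - v \<in> tangent_cone (medial_axis X))"
proof -
  define M where "M = medial_axis X"
  define \<theta> where "\<theta> = real_of_ereal (directional_curvature X v)"
  have v: "norm v = 1" using assms(9) by (simp add: camber_directions_def)
  have "u \<bullet> v = 0" if "u \<in> tangent_cone X" for u
    using camber_direction_orthogonal[of u k v] hull_inc[OF that, of affine] assms(8,9) by simp
  then have flat: "\<exists>r>0. \<forall>x\<in>X. norm x < r \<longrightarrow> \<bar>x \<bullet> v\<bar> \<le> \<eta> * norm x" if "\<eta> > 0" for \<eta>
    using that by (rule tangent_cone_orthogonal_imp_flat)
  have "1 \<le> directional_curvature X v"
    using one_le_directional_curvature[OF v flat] by simp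
  \<comment> \<open>The curvature lies between 1 and 2, hence is finite, and
    \<open>real_of_ereal\<close> returns its true value instead of the default 0.\<close>
  then have \<theta>: "1 \<le> \<theta>"
    using assms(10) unfolding \<theta>_def by (cases "directional_curvature X v") auto
  obtain w where w: "w = v \<or> w = - v" and
    exit: "\<And>c r. c > 0 \<Longrightarrow> r > 0 \<Longrightarrow>
      \<exists>x\<in>X. norm x < r \<and> c * (norm (x - (x \<bullet> w) *\<^sub>R w))\<^sup>2 < x \<bullet> w"
    using directional_curvature_less_two_exit[OF v assms(10)] by blast
  have w1: "norm w = 1" using v w by auto
  \<comment> \<open>An exit with constant 1 / \<tau> within radius \<tau> enters the open ball of
    radius \<tau> about \<tau> w.\<close>
  have close: "infdist (\<tau> *\<^sub>R w) X < \<tau>" if "\<tau> > 0" for \<tau>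
    using exit[of "inverse \<tau>" \<tau>] that infdist_less_of_quadratic_exit[OF w1 that] by auto
  have flat_w: "\<exists>r>0. \<forall>x\<in>X. norm x < r \<longrightarrow> \<bar>x \<bullet> w\<bar> \<le> \<eta> * norm x" if "\<eta> > 0" for \<eta>
    using flat[OF that] w by auto
  have cone: "\<exists>t p. 0 < t \<and> t < \<epsilon> \<and> p \<in> M \<and> dist p (t *\<^sub>R w) < \<delta> * t"
    if "\<delta> > 0" "\<epsilon> > 0" for \<delta> \<epsilon>
    using medial_axis_meets_cone[OF assms(2,4) w1 flat_w close that] unfolding M_def by blast
  have "w \<in> tangent_cone M" using tangent_cone_of_thin_cones[OF cone] .
  let ?R = "{z + t *\<^sub>R v | z t. orthogonal z v \<and> \<bar>t\<bar> > 1 * norm z powr \<theta>}"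
  have "\<exists>p\<in>M \<inter> ?R. dist p 0 < e" if "e > 0" for e
  proof -
    \<comment> \<open>Here t < 1 serves the comparison of powers, and t < e / 2 gives norm p < 5 t /
      4 < e.\<close>
    obtain t p where p: "0 < t" "t < min 1 (e / 2)" "p \<in> M" "dist p (t *\<^sub>R w) < 1 / 4 * t"
      using cone[of "1 / 4" "min 1 (e / 2)"] \<open>e > 0\<close> by auto
    then have "p \<notin> power_region v \<theta> 1"
      using cone_subset_power_region_complement[OF v w \<theta>] by simp
    then have "p \<in> ?R"
      using v unfolding power_region_iff[OF v]
      by (intro CollectI exI[of _ "p - (p \<bullet> v) *\<^sub>R v"] exI[of _ "p \<bullet> v"])
        (auto simp: orthogonal_def inner_diff_left dot_square_norm)
    moreover have "dist p 0 \<le> dist p (t *\<^sub>R w) + dist (t *\<^sub>R w) 0" by (rule dist_triangle)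
    ultimately show ?thesis using p w1 by (intro bexI[of _ p]) auto
  qed
  then have cl: "0 \<in> closure (M \<inter> ?R)" by (simp add: closure_approachable)
  then have "0 \<in> closure M" using closure_mono[of "M \<inter> ?R" M] by auto
  \<comment> \<open>The dimension is squeezed between that of the pair 0, \<open>w\<close> and that
    of the line spanned by \<open>v\<close>.\<close>
  have "aff_dim {0, w} \<le> aff_dim (tangent_cone M \<inter> span {v})"
    using \<open>w \<in> tangent_cone M\<close> zero_in_tangent_cone[OF \<open>w \<in> tangent_cone M\<close>] w
    by (intro aff_dim_subset) (auto simp: span_base span_neg span_zero)
  moreover have "aff_dim {0, w} = 1" using w1 by (auto simp: aff_dim_2)
  moreover have "aff_dim (tangent_cone M \<inter> span {v}) \<le> aff_dim (span {v})"
    by (rule aff_dim_subset) auto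
  moreover have "aff_dim (span {v}) = 1"
    using v by (auto simp: aff_dim_subspace)
  ultimately have "aff_dim (tangent_cone M \<inter> span {v}) = 1" by simp
  then show ?thesis
    using cl \<open>0 \<in> closure M\<close> \<open>w \<in> tangent_cone M\<close> w
    unfolding M_def \<theta>_def by (intro conjI exI[of _ 1]) auto
qed

end
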